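(* Let $k\ge 1$ and $n\ge 1$ be integers and let $\pi=\pi_1\pi_2\ldots\pi_n$ be a permutation of $\{1,2,\ldots,n\}$. Then $\pi$ is uniquely $k$-determined if and only if for each integer $x$ with $1\le x<n$ the distance satisfies $d_\pi(x,x+1)\le k-1$.
   Context: An $n$-permutation is a permutation of $\{1,\ldots,n\}$ written as a word $\pi=\pi_1\pi_2\ldots\pi_n$. The pattern formed by a word of $k$ distinct integers is the unique $k$-permutation order-isomorphic to it. Graph of patterns overlaps $\mathcal{P}_k$: its nodes are all $k!$ $k$-permutations, and there is an arc from $a_1\ldots a_k$ to $b_1\ldots b_k$ if and only if $a_2\ldots a_k$ and $b_1\ldots b_{k-1}$ form the same pattern. For $n\ge k$, the path in $\mathcal{P}_k$ corresponding to an $n$-permutation $\pi$ is the sequence of $n-k+1$ nodes whose $i$-th term is the pattern formed by $\pi_i\pi_{i+1}\ldots\pi_{i+k-1}$, $i=1,\ldots,n-k+1$. For $n\ge k$, an $n$-permutation $\pi$ is uniquely $k$-determined if no other $n$-permutation has the same corresponding path in $\mathcal{P}_k$. For $n<k$, every $n$-permutation is regarded as uniquely $k$-determined. Distance: for $i<j$, $d_\pi(\pi_i,\pi_j)=d_\pi(\pi_j,\pi_i)=j-i$; that is, $d_\pi(x,y)$ is the absolute difference of the positions of the values $x$ and $y$ in $\pi$. *)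

theory Defs
  imports "HOL-Combinatorics.Multiset_Permutations" "Graph_Theory.Graph_Theory"
begin

abbreviation n_permutations :: "nat \<Rightarrow> nat list set" where
  "n_permutations n \<equiv> permutations_of_set {1..n}"

definition order_isomorphic :: "'a::linorder list \<Rightarrow> 'b::linorder list \<Rightarrow> bool" where
  "order_isomorphic u v \<longleftrightarrow> length u = length v \<and>
     (\<forall>i < length u. \<forall>j < length u. u ! i < u ! j \<longleftrightarrow> v ! i < v ! j)"

text \<open>Meaningful for words with distinct letters; see \<open>pattern_ex1\<close> below.\<close>

definition pattern :: "'a::linorder list \<Rightarrow> nat list" where
  "pattern w = (THE p. p \<in> n_permutations (length w) \<and> order_isomorphic p w)"

definition overlap_graph :: "nat \<Rightarrow> nat list pair_pre_digraph" where
  "overlap_graph k = \<lparr> pverts = n_permutations k,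
     parcs = {(a, b). a \<in> n_permutations k \<and> b \<in> n_permutations k \<and>
                      pattern (tl a) = pattern (butlast b)} \<rparr>"

text \<open>Positions are 0-based list indices, and the sequence is only meaningful if
  \<open>k \<le> length \<pi>\<close>. That it is a walk in the graph is \<open>vwalk_pattern_path\<close> below.\<close>

definition pattern_path :: "nat \<Rightarrow> nat list \<Rightarrow> nat list list" where
  "pattern_path k \<pi> = map (\<lambda>i. pattern (take k (drop i \<pi>))) [0..<length \<pi> - k + 1]"

definition uniquely_determined :: "nat \<Rightarrow> nat \<Rightarrow> nat list \<Rightarrow> bool" where
  "uniquely_determined k n \<pi> \<longleftrightarrow>
     n < k \<or> \<not> (\<exists>\<sigma> \<in> n_permutations n. \<sigma> \<noteq> \<pi> \<and> pattern_path k \<sigma> = pattern_path k \<pi>)"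

definition position :: "'a list \<Rightarrow> 'a \<Rightarrow> nat" where
  "position \<pi> x = (THE i. i < length \<pi> \<and> \<pi> ! i = x)"

definition perm_dist :: "'a list \<Rightarrow> 'a \<Rightarrow> 'a \<Rightarrow> nat" where
  "perm_dist \<pi> x y = nat \<bar>int (position \<pi> x) - int (position \<pi> y)\<bar>"

lemma position_nth:
  assumes "distinct \<pi>" "i < length \<pi>"
  shows "position \<pi> (\<pi> ! i) = i"
  unfolding position_def using assms by (auto simp: nth_eq_iff_index_eq)

lemma perm_dist_nth:
  assumes "distinct \<pi>" "i < j" "j < length \<pi>"
  shows "perm_dist \<pi> (\<pi> ! i) (\<pi> ! j) = j - i" "perm_dist \<pi> (\<pi> ! j) (\<pi> ! i) = j - i"
  using assms by (auto simp: perm_dist_def position_nth)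

lemma order_isomorphic_sym: "order_isomorphic u v \<Longrightarrow> order_isomorphic v u"
  by (auto simp: order_isomorphic_def)

lemma order_isomorphic_trans:
  "order_isomorphic u v \<Longrightarrow> order_isomorphic v w \<Longrightarrow> order_isomorphic u w"
  by (auto simp: order_isomorphic_def)

lemma order_isomorphic_tl: "order_isomorphic u v \<Longrightarrow> order_isomorphic (tl u) (tl v)"
  by (auto simp: order_isomorphic_def nth_tl)

lemma order_isomorphic_butlast:
  "order_isomorphic u v \<Longrightarrow> order_isomorphic (butlast u) (butlast v)"
  by (auto simp: order_isomorphic_def nth_butlast)

lemma length_n_permutation: "p \<in> n_permutations n \<Longrightarrow> length p = n"
  using length_finite_permutations_of_set by fastforce

lemma n_permutation_rank:
  assumes "p \<in> n_permutations n" "i < n"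
  shows "p ! i = Suc (card {j. j < n \<and> p ! j < p ! i})"
proof -
  have len: "length p = n" using assms length_n_permutation by blast
  have d: "distinct p" "set p = {1..n}"
    using assms by (auto simp: permutations_of_set_def)
  have pi: "p ! i \<in> {1..n}" using assms len d nth_mem by metis
  have "(\<lambda>j. p ! j) ` {j. j < n \<and> p ! j < p ! i} = {1..<p ! i}"
  proof (intro equalityI subsetI)
    fix x assume "x \<in> (\<lambda>j. p ! j) ` {j. j < n \<and> p ! j < p ! i}"
    then show "x \<in> {1..<p ! i}" using d len nth_mem by fastforce
  next
    fix x assume "x \<in> {1..<p ! i}"
    then have "x \<in> set p" using d pi by auto
    then show "x \<in> (\<lambda>j. p ! j) ` {j. j < n \<and> p ! j < p ! i}"
      using \<open>x \<in> {1..<p ! i}\<close> len by (auto simp: in_set_conv_nth)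
  qed
  moreover have "inj_on (\<lambda>j. p ! j) {j. j < n \<and> p ! j < p ! i}"
    using d len by (auto simp: inj_on_def nth_eq_iff_index_eq)
  ultimately have "card {j. j < n \<and> p ! j < p ! i} = card {1..<p ! i}"
    by (metis card_image)
  then show ?thesis using pi by simp
qed

lemma n_permutation_eqI:
  assumes "p \<in> n_permutations n" "q \<in> n_permutations n" "order_isomorphic p q"
  shows "p = q"
proof (rule nth_equalityI)
  show "length p = length q" using assms by (simp add: order_isomorphic_def)
  fix i assume "i < length p"
  then have i: "i < n" and len: "length p = n"
    using assms(1) length_n_permutation by auto
  have "{j. j < n \<and> p ! j < p ! i} = {j. j < n \<and> q ! j < q ! i}"
    using assms(3) i len by (auto simp: order_isomorphic_def)
  then show "p ! i = q ! i"
    using n_permutation_rank[OF assms(1) i] n_permutation_rank[OF assms(2) i] by simp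
qed

lemma pattern_ex1:
  fixes w :: "'a::linorder list"
  assumes "distinct w"
  shows "\<exists>!p. p \<in> n_permutations (length w) \<and> order_isomorphic p w"
proof (rule ex_ex1I)
  define r where "r = (\<lambda>x. card {y \<in> set w. y \<le> x})"
  have mono: "r x < r y" if "x \<in> set w" "y \<in> set w" "x < y" for x y
  proof -
    have "y \<in> {z \<in> set w. z \<le> y} - {z \<in> set w. z \<le> x}" using that by auto
    moreover have "{z \<in> set w. z \<le> x} \<subseteq> {z \<in> set w. z \<le> y}" using that by auto
    ultimately have "{z \<in> set w. z \<le> x} \<subset> {z \<in> set w. z \<le> y}" by blast
    then show ?thesis unfolding r_def by (intro psubset_card_mono) auto
  qed
  have iff: "r x < r y \<longleftrightarrow> x < y" if "x \<in> set w" "y \<in> set w" for x y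
    using mono that by (metis less_asym' linorder_neqE less_irrefl)
  have inj: "inj_on r (set w)"
    by (rule inj_onI) (metis iff less_irrefl linorder_neqE)
  have "r x \<in> {1..length w}" if "x \<in> set w" for x
  proof -
    have "0 < r x" unfolding r_def using that by (auto simp: card_gt_0_iff)
    moreover have "r x \<le> card (set w)" unfolding r_def by (intro card_mono) auto
    ultimately show ?thesis using assms by (simp add: distinct_card)
  qed
  then have "r ` set w \<subseteq> {1..length w}" by auto
  moreover have "card (r ` set w) = length w"
    using inj assms by (simp add: card_image distinct_card)
  ultimately have "r ` set w = {1..length w}"
    by (intro card_subset_eq) auto
  then have "map r w \<in> n_permutations (length w)"
    using inj assms by (auto simp: permutations_of_set_def distinct_map)
  moreover have "order_isomorphic (map r w) w"
    by (auto simp: order_isomorphic_def iff)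
  ultimately show "\<exists>p. p \<in> n_permutations (length w) \<and> order_isomorphic p w" by blast
next
  fix p q
  assume "p \<in> n_permutations (length w) \<and> order_isomorphic p w"
    and "q \<in> n_permutations (length w) \<and> order_isomorphic q w"
  then show "p = q"
    by (meson n_permutation_eqI order_isomorphic_sym order_isomorphic_trans)
qed

lemma
  assumes "distinct w"
  shows pattern_in_n_permutations: "pattern w \<in> n_permutations (length w)"
    and order_isomorphic_pattern: "order_isomorphic (pattern w) w"
  using theI'[OF pattern_ex1[OF assms]] unfolding pattern_def by auto

lemma pattern_cong:
  assumes "order_isomorphic u v"
  shows "pattern u = pattern v"
proof -
  have "order_isomorphic p u \<longleftrightarrow> order_isomorphic p v" for p :: "nat list"
    using assms order_isomorphic_sym order_isomorphic_trans by metis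
  moreover have "length u = length v" using assms by (simp add: order_isomorphic_def)
  ultimately show ?thesis by (simp add: pattern_def)
qed

lemma vwalk_arcs_conv_nth:
  "set (vwalk_arcs p) = {(p ! i, p ! Suc i) |i. Suc i < length p}"
proof (induction p rule: vwalk_arcs.induct)
  case (3 x y xs)
  have "{((x # y # xs) ! i, (x # y # xs) ! Suc i) |i. Suc i < length (x # y # xs)} =
    insert (x, y) {((y # xs) ! i, (y # xs) ! Suc i) |i. Suc i < length (y # xs)}"
    (is "?L = ?R")
  proof (intro equalityI subsetI)
    fix e assume "e \<in> ?L"
    then obtain i where i: "e = ((x # y # xs) ! i, (x # y # xs) ! Suc i)"
      "Suc i < length (x # y # xs)" by blast
    then show "e \<in> ?R" by (cases i) auto
  next
    fix e assume "e \<in> ?R"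
    then consider "e = (x, y)" |
      i where "e = ((y # xs) ! i, (y # xs) ! Suc i)" "Suc i < length (y # xs)" by blast
    then show "e \<in> ?L"
    proof cases
      case 1 then show ?thesis by (auto intro!: exI[of _ 0])
    next
      case 2 then show ?thesis by (auto intro!: exI[of _ "Suc i"])
    qed
  qed
  then show ?case using 3 by simp
qed auto

lemma vwalk_pattern_path:
  assumes "\<pi> \<in> n_permutations n" "1 \<le> k" "k \<le> n"
  shows "vwalk (pattern_path k \<pi>) (with_proj (overlap_graph k))"
    and "length (pattern_path k \<pi>) = n - k + 1"
proof -
  let ?w = "\<lambda>i. take k (drop i \<pi>)"
  have len: "length \<pi> = n" using assms(1) by (rule length_n_permutation)
  then show lp: "length (pattern_path k \<pi>) = n - k + 1" by (simp add: pattern_path_def)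
  have dist: "distinct (?w i)" for i
    using assms(1) by (simp add: permutations_of_set_def)
  have nth: "pattern_path k \<pi> ! i = pattern (?w i)" if "i < n - k + 1" for i
    using that len by (simp add: pattern_path_def del: upt_Suc)
  have vert: "pattern (?w i) \<in> n_permutations k" if "i < n - k + 1" for i
    using pattern_in_n_permutations[OF dist[of i]] that len assms by simp
  have arc: "pattern (tl (pattern (?w i))) = pattern (butlast (pattern (?w (Suc i))))"
    if "Suc i < n - k + 1" for i
  proof -
    have "tl (?w i) = butlast (?w (Suc i))"
      using that len assms by (intro nth_equalityI) (auto simp: nth_tl nth_butlast)
    moreover have "pattern (tl (pattern (?w i))) = pattern (tl (?w i))"
      by (intro pattern_cong order_isomorphic_tl order_isomorphic_pattern dist)
    moreover have "pattern (butlast (pattern (?w (Suc i)))) = pattern (butlast (?w (Suc i)))"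
      by (intro pattern_cong order_isomorphic_butlast order_isomorphic_pattern dist)
    ultimately show ?thesis by simp
  qed
  show "vwalk (pattern_path k \<pi>) (with_proj (overlap_graph k))"
  proof (rule vwalkI)
    show "set (pattern_path k \<pi>) \<subseteq> verts (with_proj (overlap_graph k))"
      using vert nth lp by (auto simp: overlap_graph_def in_set_conv_nth)
    show "set (vwalk_arcs (pattern_path k \<pi>)) \<subseteq> arcs_ends (with_proj (overlap_graph k))"
      using vert nth arc lp
      by (auto simp: vwalk_arcs_conv_nth overlap_graph_def arcs_ends_def arc_to_ends_def)
    show "pattern_path k \<pi> \<noteq> []" using lp by auto
  qed
qed

end

theory Submission
  imports Defs
begin

text \<open>
  The path of a permutation records exactly the relative order of the entries at positions less
  than \<open>k\<close> apart. If all consecutive values lie that close together, the path fixes the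
  order of \<open>x\<close> and \<open>x + 1\<close> for every \<open>x\<close>, hence by transitivity the whole permutation.
  Conversely, if \<open>x\<close> and \<open>x + 1\<close> are at distance at least \<open>k\<close>, then swapping them changes
  no pattern of length \<open>k\<close>, because no other value separates them.
\<close>

lemma pattern_eq_iff_order_isomorphic:
  assumes "distinct u" "distinct v"
  shows "pattern u = pattern v \<longleftrightarrow> order_isomorphic u v"
  using order_isomorphic_pattern[OF assms(1)] order_isomorphic_pattern[OF assms(2)]
  by (metis order_isomorphic_sym order_isomorphic_trans pattern_cong)

text \<open>Equal patterns mean order-isomorphic windows, and two positions share a window of length
  \<open>k\<close> exactly when they are less than \<open>k\<close> apart.\<close>

lemma pattern_path_eq_iff:
  assumes "distinct \<sigma>" "distinct \<pi>" "length \<sigma> = n" "length \<pi> = n" "k \<le> n"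
  shows "pattern_path k \<sigma> = pattern_path k \<pi> \<longleftrightarrow>
    (\<forall>i<n. \<forall>j<n. i < j + k \<and> j < i + k \<longrightarrow> (\<sigma> ! i < \<sigma> ! j \<longleftrightarrow> \<pi> ! i < \<pi> ! j))"
    (is "_ \<longleftrightarrow> ?local")
proof -
  have "pattern_path k \<sigma> = pattern_path k \<pi> \<longleftrightarrow>
      (\<forall>m \<le> n - k. order_isomorphic (take k (drop m \<sigma>)) (take k (drop m \<pi>)))"
    using assms by (auto simp: pattern_path_def pattern_eq_iff_order_isomorphic)
  also have "\<dots> \<longleftrightarrow> (\<forall>m \<le> n - k. \<forall>a<k. \<forall>b<k.
      \<sigma> ! (m + a) < \<sigma> ! (m + b) \<longleftrightarrow> \<pi> ! (m + a) < \<pi> ! (m + b))" (is "_ \<longleftrightarrow> ?windows")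
    using assms by (auto simp: order_isomorphic_def)
  also have "\<dots> \<longleftrightarrow> ?local"
  proof
    assume windows: ?windows
    show ?local
    proof (intro allI impI)
      fix i j assume ij: "i < n" "j < n" "i < j + k \<and> j < i + k"
      \<comment> \<open>The window starts at the smaller of the two positions, unless it would then
        run past the end; in that case the last window, starting at \<open>n - k\<close>, contains
        both.\<close>
      define m where "m = min (min i j) (n - k)"
      have "m \<le> n - k" "i - m < k" "j - m < k" "m + (i - m) = i" "m + (j - m) = j"
        using ij \<open>k \<le> n\<close> unfolding m_def by linarith+
      then show "\<sigma> ! i < \<sigma> ! j \<longleftrightarrow> \<pi> ! i < \<pi> ! j"
        using windows by metis
    qed
  next
    assume ?local
    then show ?windows using \<open>k \<le> n\<close> by simp
  qed
  finally show ?thesis .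
qed

lemma n_permutation_position:
  assumes "\<pi> \<in> n_permutations n" "1 \<le> x" "x \<le> n"
  shows "position \<pi> x < n" "\<pi> ! position \<pi> x = x"
proof -
  have "distinct \<pi>" "x \<in> set \<pi>" "length \<pi> = n"
    using assms length_n_permutation by (auto simp: permutations_of_set_def)
  then obtain i where "i < n" "\<pi> ! i = x" by (auto simp: in_set_conv_nth)
  then show "position \<pi> x < n" "\<pi> ! position \<pi> x = x"
    using position_nth[of \<pi> i] \<open>distinct \<pi>\<close> \<open>length \<pi> = n\<close> by auto
qed

text \<open>Brings the distance bound into the subtraction-free form of the closeness condition in
  \<open>pattern_path_eq_iff\<close>.\<close>

lemma perm_dist_less_iff:
  "perm_dist \<pi> x y < k \<longleftrightarrow> position \<pi> x < position \<pi> y + k \<and> position \<pi> y < position \<pi> x + k"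
  unfolding perm_dist_def by linarith

lemma map_transpose_n_permutation:
  assumes "\<pi> \<in> n_permutations n" "x \<in> {1..n}" "y \<in> {1..n}"
  shows "map (Transposition.transpose x y) \<pi> \<in> n_permutations n"
proof -
  have "set \<pi> = {1..n}" "distinct \<pi>" using assms by (auto simp: permutations_of_set_def)
  then show ?thesis
    using assms by (auto simp: permutations_of_set_def distinct_map)
qed

text \<open>No natural number lies strictly between \<open>x\<close> and \<open>Suc x\<close>, so
  any third value compares in the same way with both; only the pair itself changes its
  order.\<close>

lemma transpose_Suc_less_iff:
  assumes "{a, b} \<noteq> {x, Suc x}"
  shows "Transposition.transpose x (Suc x) a < Transposition.transpose x (Suc x) b \<longleftrightarrow> a < b"
  using assms by (auto simp: Transposition.transpose_def)

text \<open>The map sending a value \<open>v\<close> to the entry of \<open>\<sigma>\<close> at the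
  position of \<open>v\<close> in \<open>\<pi>\<close> increases at every step, hence is strictly
  increasing on \<open>{1..n}\<close>. This makes the two words order-isomorphic.\<close>

lemma n_permutation_eqI_adjacent:
  assumes \<pi>: "\<pi> \<in> n_permutations n" and \<sigma>: "\<sigma> \<in> n_permutations n"
    and adjacent: "\<And>x. 1 \<le> x \<Longrightarrow> x < n \<Longrightarrow>
      \<sigma> ! position \<pi> x < \<sigma> ! position \<pi> (Suc x)"
  shows "\<sigma> = \<pi>"
proof -
  have len: "length \<pi> = n" "length \<sigma> = n" using \<pi> \<sigma> length_n_permutation by auto
  have d: "distinct \<pi>" "set \<pi> = {1..n}" using \<pi> by (auto simp: permutations_of_set_def)
  have increasing: "\<sigma> ! position \<pi> x < \<sigma> ! position \<pi> y" if "x < y" "1 \<le> x" "y \<le> n" for x y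
    using that
  proof (induction y)
    case (Suc y)
    then show ?case
      using adjacent[of y] by (cases "x = y") auto
  qed simp
  have mono: "\<sigma> ! i < \<sigma> ! j" if "\<pi> ! i < \<pi> ! j" "i < n" "j < n" for i j
  proof -
    have "\<pi> ! i \<in> {1..n}" "\<pi> ! j \<in> {1..n}" using that d len nth_mem by metis+
    then show ?thesis
      using increasing[of "\<pi> ! i" "\<pi> ! j"] that d len by (simp add: position_nth)
  qed
  \<comment> \<open>The converse of \<open>mono\<close> follows by trichotomy: equal entries of
    \<open>\<pi>\<close> force \<open>i = j\<close>, and the reversed order in \<open>\<pi>\<close>
    would be reversed in \<open>\<sigma>\<close> too.\<close>
  have "\<sigma> ! i < \<sigma> ! j \<longleftrightarrow> \<pi> ! i < \<pi> ! j" if "i < n" "j < n" for i j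
    using mono that d(1) len
    by (metis less_asym less_irrefl linorder_neqE_nat nth_eq_iff_index_eq)
  then have "order_isomorphic \<sigma> \<pi>" using len by (simp add: order_isomorphic_def)
  with \<sigma> \<pi> show ?thesis by (rule n_permutation_eqI)
qed

theorem theorem1:
  fixes k n :: nat and \<pi> :: "nat list"
  assumes "k \<ge> 1" and "n \<ge> 1" and "\<pi> \<in> n_permutations n"
  shows "uniquely_determined k n \<pi> \<longleftrightarrow>
    (\<forall>x. 1 \<le> x \<and> x < n \<longrightarrow> perm_dist \<pi> x (x + 1) \<le> k - 1)"
proof -
  have len: "length \<pi> = n" using assms(3) by (rule length_n_permutation)
  have dist: "distinct \<pi>" using assms(3) by (simp add: permutations_of_set_def)
  \<comment> \<open>Here \<open>1 \<le> k\<close> matters: with truncated subtraction the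
    equivalence fails for \<open>k = 0\<close> and \<open>d = 0\<close>.\<close>
  have le_iff: "d \<le> k - 1 \<longleftrightarrow> d < k" for d using assms(1) by linarith
  show ?thesis
  proof (cases "n < k")
    case True
    \<comment> \<open>Both sides hold in this case: all positions lie below \<open>n < k\<close>, so
      no distance can reach \<open>k\<close>.\<close>
    have "perm_dist \<pi> x (x + 1) < k" if "1 \<le> x" "x < n" for x
      using n_permutation_position(1)[OF assms(3), of x]
        n_permutation_position(1)[OF assms(3), of "x + 1"] that True
      by (auto simp: perm_dist_less_iff)
    with True show ?thesis unfolding uniquely_determined_def le_iff by blast
  next
    case False
    then have "k \<le> n" by simp
    have path_iff: "pattern_path k \<sigma> = pattern_path k \<pi> \<longleftrightarrow>
        (\<forall>i<n. \<forall>j<n. i < j + k \<and> j < i + k \<longrightarrow> (\<sigma> ! i < \<sigma> ! j \<longleftrightarrow> \<pi> ! i < \<pi> ! j))"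
      if "\<sigma> \<in> n_permutations n" for \<sigma>
      using that dist len \<open>k \<le> n\<close> length_n_permutation[OF that]
      by (intro pattern_path_eq_iff) (auto simp: permutations_of_set_def)
    show ?thesis
    proof
      assume unique: "uniquely_determined k n \<pi>"
      show "\<forall>x. 1 \<le> x \<and> x < n \<longrightarrow> perm_dist \<pi> x (x + 1) \<le> k - 1"
      proof (rule ccontr)
        assume "\<not> ?thesis"
        then obtain x where x: "1 \<le> x" "x < n" "\<not> perm_dist \<pi> x (Suc x) < k"
          unfolding le_iff by auto
        define \<sigma> where "\<sigma> = map (Transposition.transpose x (Suc x)) \<pi>"
        have \<sigma>: "\<sigma> \<in> n_permutations n"
          unfolding \<sigma>_def using assms(3) x by (intro map_transpose_n_permutation) auto
        have "pattern_path k \<sigma> = pattern_path k \<pi>"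
          unfolding path_iff[OF \<sigma>]
        proof (intro allI impI)
          fix i j assume ij: "i < n" "j < n" "i < j + k \<and> j < i + k"
          \<comment> \<open>Positions \<open>i\<close> and \<open>j\<close> are too close together
            to carry both swapped values, so \<open>transpose_Suc_less_iff\<close> applies.\<close>
          have "{\<pi> ! i, \<pi> ! j} \<noteq> {x, Suc x}"
          proof
            assume "{\<pi> ! i, \<pi> ! j} = {x, Suc x}"
            then have "\<pi> ! i = x \<and> \<pi> ! j = Suc x \<or> \<pi> ! i = Suc x \<and> \<pi> ! j = x"
              by (auto simp: doubleton_eq_iff)
            then have "perm_dist \<pi> x (Suc x) < k"
              unfolding perm_dist_less_iff
              using position_nth[OF dist, of i] position_nth[OF dist, of j] ij len by auto
            with x(3) show False by simp
          qed
          then show "\<sigma> ! i < \<sigma> ! j \<longleftrightarrow> \<pi> ! i < \<pi> ! j"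
            using ij len by (simp add: \<sigma>_def transpose_Suc_less_iff)
        qed
        \<comment> \<open>At the position of \<open>x\<close>, the word \<open>\<sigma>\<close> has
          the entry \<open>Suc x\<close>.\<close>
        moreover have "\<sigma> ! position \<pi> x \<noteq> \<pi> ! position \<pi> x"
          using n_permutation_position[OF assms(3), of x] x len by (simp add: \<sigma>_def)
        ultimately show False
          using unique False \<sigma> by (auto simp: uniquely_determined_def)
      qed
    next
      assume close: "\<forall>x. 1 \<le> x \<and> x < n \<longrightarrow> perm_dist \<pi> x (x + 1) \<le> k - 1"
      have "\<sigma> = \<pi>" if \<sigma>: "\<sigma> \<in> n_permutations n" and path: "pattern_path k \<sigma> = pattern_path k \<pi>"
        for \<sigma>
      proof (rule n_permutation_eqI_adjacent[OF assms(3) \<sigma>])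
        fix x assume x: "1 \<le> x" "x < n"
        then have "perm_dist \<pi> x (Suc x) < k" using close unfolding le_iff by simp
        \<comment> \<open>The distance bound puts the positions of \<open>x\<close> and
          \<open>Suc x\<close> within the range of \<open>path_iff\<close>, which transfers
          \<open>x < Suc x\<close> from \<open>\<pi>\<close> to \<open>\<sigma>\<close>.\<close>
        then show "\<sigma> ! position \<pi> x < \<sigma> ! position \<pi> (Suc x)"
          using path[unfolded path_iff[OF \<sigma>]] x n_permutation_position[OF assms(3), of x]
            n_permutation_position[OF assms(3), of "Suc x"]
          by (simp add: perm_dist_less_iff)
      qed
      then show "uniquely_determined k n \<pi>" by (auto simp: uniquely_determined_def)
    qed
  qed
qed

end
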